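(* Let $w_I^n\in\Omega$ for all $I\in\mathcal I$, with the relaxation parameters $a$ at the interfaces chosen sufficiently large (in the sense specified in the context). Then under the CFL condition $$\frac{\Delta t}{\Delta x_i}\max|\lambda_i|<\frac1{2d}\qquad\text{for all } i\in\{1,\dots,d\},$$ where $\max|\lambda_i|$ is the maximum (supremum) of $|\lambda^-|,|\lambda^{\mathbf u}|,|\lambda^+|$ over all interfaces in direction $i$, the first order scheme is robust, i.e. $w_I^{n+1}\in\Omega$ for all $I\in\mathcal I$.
   Context: **Equations.** The compressible Euler equations with gravity in $d$ space dimensions are $$\partial_t\rho+\nabla\cdot(\rho\mathbf u)=0,\quad \partial_t(\rho\mathbf u)+\nabla\cdot(\rho\mathbf u\otimes\mathbf u+\mathrm{Id}\,p)=-\rho\nabla\Phi,\quad \partial_tE+\nabla\cdot((E+p)\mathbf u)=-\rho\langle\mathbf u,\nabla\Phi\rangle,$$ with $E=\rho e+\tfrac12\rho\|\mathbf u\|^2$, a given potential $\Phi:\mathbb R^d\to\mathbb R$ and a general pressure law $p=p(\tau,e)$, $\tau=1/\rho$. Write $w=(\rho,\rho\mathbf u,E)$. The admissible set is $\Omega=\{w\in\mathbb R^{d+2}:\rho>0,\ e>0\}$. Positive functions $\alpha,\beta$ on $\mathbb R^d$ with $\nabla\beta=-\alpha\nabla\Phi$ are given (they describe the hydrostatic equilibrium $\mathbf u=0,\rho=\alpha,p=\beta$). **Mesh.** Uniform Cartesian mesh with step sizes $\Delta x_i>0$, $i=1,\dots,d$, cell centres $\mathbf x_I$, $I=(I_1,\dots,I_d)\in\mathcal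 I=\mathbb Z^d$; $I(i,k)$ denotes $I$ with $I_i$ replaced by $I_i+k$; $I(i,\pm\frac12)$ labels the interface between $C_I$ and $C_{I(i,\pm1)}$. $w_I^n$ is the cell value at time $t^n$; $\alpha_I=\alpha(\mathbf x_I)$, $\beta_I=\beta(\mathbf x_I)$, $p_I=p(1/\rho_I,e_I)$. $\mathbf n_i$ is the $i$-th unit vector. **Interface solver in direction $i$.** Relaxation states are $W=(\rho,\rho\mathbf u,E,\rho\pi,\rho Z)$; the relaxation equilibrium state of a cell value $w_I$ is $W_I=(\rho_I,\rho_I\mathbf u_I,E_I,\rho_Ip_I,\rho_I\Phi(\mathbf x_I))$. Given left and right states $W_L,W_R$, a number $\overline S$ and a relaxation parameter $a>0$, let $u$ denote the $i$-th velocity component and define $$u^*=\tfrac12(u_L+u_R)-\tfrac1{2a}(\pi_R-\pi_L-\overline S),$$ $$\tfrac1{\rho_L^*}=\tfrac1{\rho_L}+\tfrac1a(u^*-u_L),\quad \tfrac1{\rho_R^*}=\tfrac1{\rho_R}+\tfrac1a(u_R-u^* ),\quad \pi_L^*=\pi_L+a(u_L-u^* ),\quad \pi_R^*=\pi_R+a(u^*-u_R),$$ $$e_{L}^*=e_{L}+\tfrac{(\pi_{L}^* )^2-\pi_{L}^2}{2a^2},\quad e_{R}^*=e_{R}+\tfrac{(\pi_{R}^* )^2-\pi_{R}^2}{2a^2},\quad Z_{L}^*=Z_{L},\quad Z_R^*=Z_R,$$ where the $i$-th velocity component of both $W_L^*$ and $W_R^*$ is $u^*$, the other velocity components are those of $W_L$,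 respectively $W_R$, and $E^*=\rho^*e^*+\frac12\rho^*\|\mathbf u^*\|^2$. The wave speeds are $\lambda^-=u_L-a/\rho_L$, $\lambda^{\mathbf u}=u^*$, $\lambda^+=u_R+a/\rho_R$. The relaxation parameter $a$ at an interface is called sufficiently large if $\lambda^-<\lambda^{\mathbf u}<\lambda^+$ and the $(\rho,\rho\mathbf u,E)$-parts of $W_L^*$ and $W_R^*$ belong to $\Omega$. **Source discretization.** $$\overline S(W_L,W_R)=\Big(\tfrac{\rho_R}{\alpha_R}\beta_R-\tfrac{\rho_L}{\alpha_L}\beta_L\Big)-\tfrac12\Big(\tfrac{\rho_R}{\alpha_R}-\tfrac{\rho_L}{\alpha_L}\Big)(\beta_R+\beta_L),$$ where $\alpha_{L,R},\beta_{L,R}$ are the values of $\alpha,\beta$ at the centres of the left/right cell. **Numerical fluxes.** Let $F_{1,i}(W)=(\rho u_i,\ \rho u_i\mathbf u+\pi\mathbf n_i,\ u_i(E+\pi))\in\mathbb R^{d+2}$. At interface $I(i,\frac12)$ use $W_L=W_I$, $W_R=W_{I(i,1)}$, $\overline S=\overline S(W_I,W_{I(i,1)})$, $S=(0,\mathbf n_i\overline S,\lambda^{\mathbf u}\overline S)$, and set $$(F^-_{I(i,1/2)},F^+_{I(i,1/2)})=\begin{cases}(F_{1,i}(W_L),\,F_{1,i}(W_L)+S)&\lambda^-\ge0\\(F_{1,i}(W_L^* ),\,F_{1,i}(W_L^* )+S)&\lambda^{\mathbf u}>0>\lambda^-\\(F_{1,i}(W_L^* ),\,F_{1,i}(W_R^*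 ))&\lambda^{\mathbf u}=0\\(F_{1,i}(W_R^* )-S,\,F_{1,i}(W_R^* ))&\lambda^+>0>\lambda^{\mathbf u}\\(F_{1,i}(W_R)-S,\,F_{1,i}(W_R))&\lambda^+\le0.\end{cases}$$ **First order scheme.** With time step $\Delta t>0$, $$w_I^{n+1}=w_I^n-\Delta t\sum_{i=1}^d\frac1{\Delta x_i}\big(F^-_{I(i,1/2)}-F^+_{I(i,-1/2)}\big).$$ *)

theory Defs
  imports "HOL-Analysis.Analysis"
begin

text \<open>A state is the tuple of conserved variables (rho, rho u, E), an element of R^(d+2) with
  d = CARD('d). The velocity and the internal energy are recovered from it.\<close>

type_synonym 'd state = "real \<times> (real^'d) \<times> real"

definition density :: "'d::finite state \<Rightarrow> real" where
  "density w = fst w"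

definition momentum :: "'d::finite state \<Rightarrow> real^'d" where
  "momentum w = fst (snd w)"

definition energy :: "'d::finite state \<Rightarrow> real" where
  "energy w = snd (snd w)"

definition velocity :: "'d::finite state \<Rightarrow> real^'d" where
  "velocity w = (1 / density w) *\<^sub>R momentum w"

text \<open>The relation E = rho e + 1/2 rho |u|^2, solved for e.\<close>

definition internal_energy :: "'d::finite state \<Rightarrow> real" where
  "internal_energy w = (energy w - 1/2 * density w * (norm (velocity w))\<^sup>2) / density w"

definition Omega :: "'d::finite state set" where
  "Omega = {w. density w > 0 \<and> internal_energy w > 0}"

definition state_of :: "real \<Rightarrow> real^'d \<Rightarrow> real \<Rightarrow> 'd::finite state" where
  "state_of \<rho> u e = (\<rho>, \<rho> *\<^sub>R u, \<rho> * e + 1/2 * \<rho> * (norm u)\<^sup>2)"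

text \<open>The pressure law p takes the specific volume tau = 1/rho and the internal energy e.\<close>

definition pressure :: "(real \<Rightarrow> real \<Rightarrow> real) \<Rightarrow> 'd::finite state \<Rightarrow> real" where
  "pressure p w = p (1 / density w) (internal_energy w)"

text \<open>Relaxation states W = (rho, rho u, E, rho pi, rho Z).\<close>

record ('d::finite) relax_state =
  conserved :: "'d state"
  rho_pi :: real
  rho_Z :: real

definition relax_pi :: "'d::finite relax_state \<Rightarrow> real" where
  "relax_pi W = rho_pi W / density (conserved W)"

definition relax_Z :: "'d::finite relax_state \<Rightarrow> real" where
  "relax_Z W = rho_Z W / density (conserved W)"

text \<open>The argument phi is the value of the potential at the cell centre.\<close>

definition relax_equilibrium ::
    "(real \<Rightarrow> real \<Rightarrow> real) \<Rightarrow> real \<Rightarrow> 'd::finite state \<Rightarrow> 'd relax_state" where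
  "relax_equilibrium p \<phi> w =
     \<lparr>conserved = w, rho_pi = density w * pressure p w, rho_Z = density w * \<phi>\<rparr>"

record ('d::finite) iface =
  dir :: 'd
  par_a :: real
  Sbar :: real
  W_L :: "'d relax_state"
  W_R :: "'d relax_state"

definition rho_L :: "'d::finite iface \<Rightarrow> real" where
  "rho_L R = density (conserved (W_L R))"

definition rho_R :: "'d::finite iface \<Rightarrow> real" where
  "rho_R R = density (conserved (W_R R))"

definition u_L :: "'d::finite iface \<Rightarrow> real" where
  "u_L R = velocity (conserved (W_L R)) $ dir R"

definition u_R :: "'d::finite iface \<Rightarrow> real" where
  "u_R R = velocity (conserved (W_R R)) $ dir R"

definition pi_L :: "'d::finite iface \<Rightarrow> real" where
  "pi_L R = relax_pi (W_L R)"

definition pi_R :: "'d::finite iface \<Rightarrow> real" where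
  "pi_R R = relax_pi (W_R R)"

definition e_L :: "'d::finite iface \<Rightarrow> real" where
  "e_L R = internal_energy (conserved (W_L R))"

definition e_R :: "'d::finite iface \<Rightarrow> real" where
  "e_R R = internal_energy (conserved (W_R R))"

definition u_star :: "'d::finite iface \<Rightarrow> real" where
  "u_star R = 1/2 * (u_L R + u_R R) - 1 / (2 * par_a R) * (pi_R R - pi_L R - Sbar R)"

text \<open>The two intermediate densities are given through their reciprocals. If such a reciprocal
  vanishes, then the density below is 0, so that the intermediate state is not admissible.\<close>

definition rho_L_star :: "'d::finite iface \<Rightarrow> real" where
  "rho_L_star R = 1 / (1 / rho_L R + 1 / par_a R * (u_star R - u_L R))"

definition rho_R_star :: "'d::finite iface \<Rightarrow> real" where
  "rho_R_star R = 1 / (1 / rho_R R + 1 / par_a R * (u_R R - u_star R))"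

definition pi_L_star :: "'d::finite iface \<Rightarrow> real" where
  "pi_L_star R = pi_L R + par_a R * (u_L R - u_star R)"

definition pi_R_star :: "'d::finite iface \<Rightarrow> real" where
  "pi_R_star R = pi_R R + par_a R * (u_star R - u_R R)"

definition e_L_star :: "'d::finite iface \<Rightarrow> real" where
  "e_L_star R = e_L R + ((pi_L_star R)\<^sup>2 - (pi_L R)\<^sup>2) / (2 * (par_a R)\<^sup>2)"

definition e_R_star :: "'d::finite iface \<Rightarrow> real" where
  "e_R_star R = e_R R + ((pi_R_star R)\<^sup>2 - (pi_R R)\<^sup>2) / (2 * (par_a R)\<^sup>2)"

definition vel_L_star :: "'d::finite iface \<Rightarrow> real^'d" where
  "vel_L_star R =
     (\<chi> j. if j = dir R then u_star R else velocity (conserved (W_L R)) $ j)"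

definition vel_R_star :: "'d::finite iface \<Rightarrow> real^'d" where
  "vel_R_star R =
     (\<chi> j. if j = dir R then u_star R else velocity (conserved (W_R R)) $ j)"

definition W_L_star :: "'d::finite iface \<Rightarrow> 'd relax_state" where
  "W_L_star R =
     \<lparr>conserved = state_of (rho_L_star R) (vel_L_star R) (e_L_star R),
      rho_pi = rho_L_star R * pi_L_star R,
      rho_Z = rho_L_star R * relax_Z (W_L R)\<rparr>"

definition W_R_star :: "'d::finite iface \<Rightarrow> 'd relax_state" where
  "W_R_star R =
     \<lparr>conserved = state_of (rho_R_star R) (vel_R_star R) (e_R_star R),
      rho_pi = rho_R_star R * pi_R_star R,
      rho_Z = rho_R_star R * relax_Z (W_R R)\<rparr>"

definition speed_minus :: "'d::finite iface \<Rightarrow> real" where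
  "speed_minus R = u_L R - par_a R / rho_L R"

definition speed_u :: "'d::finite iface \<Rightarrow> real" where
  "speed_u R = u_star R"

definition speed_plus :: "'d::finite iface \<Rightarrow> real" where
  "speed_plus R = u_R R + par_a R / rho_R R"

definition sufficiently_large :: "'d::finite iface \<Rightarrow> bool" where
  "sufficiently_large R \<longleftrightarrow>
     par_a R > 0 \<and>
     speed_minus R < speed_u R \<and> speed_u R < speed_plus R \<and>
     conserved (W_L_star R) \<in> Omega \<and> conserved (W_R_star R) \<in> Omega"

definition F1 :: "'d \<Rightarrow> 'd::finite relax_state \<Rightarrow> 'd state" where
  "F1 i W =
     (let \<rho> = density (conserved W); u = velocity (conserved W); E = energy (conserved W);
          \<pi> = relax_pi W
      in (\<rho> * u $ i, (\<rho> * u $ i) *\<^sub>R u + \<pi> *\<^sub>R axis i 1, u $ i * (E + \<pi>)))"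

definition flux_source :: "'d::finite iface \<Rightarrow> 'd state" where
  "flux_source R = (0, Sbar R *\<^sub>R axis (dir R) 1, speed_u R * Sbar R)"

text \<open>The pair (F^-, F^+) of the fluxes seen by the left and by the right cell. If the three speeds
  are strictly increasing, the last branch is exactly the case speed_plus R <= 0.\<close>

definition num_flux :: "'d::finite iface \<Rightarrow> 'd state \<times> 'd state" where
  "num_flux R =
     (let F = F1 (dir R); S = flux_source R in
      if speed_minus R \<ge> 0 then (F (W_L R), F (W_L R) + S)
      else if speed_u R > 0 \<and> 0 > speed_minus R then (F (W_L_star R), F (W_L_star R) + S)
      else if speed_u R = 0 then (F (W_L_star R), F (W_R_star R))
      else if speed_plus R > 0 \<and> 0 > speed_u R then (F (W_R_star R) - S, F (W_R_star R))
      else (F (W_R R) - S, F (W_R R)))"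

text \<open>The vector x0 is the centre of the cell with multi-index 0.\<close>

definition centre :: "real^'d \<Rightarrow> real^'d \<Rightarrow> int^'d \<Rightarrow> real^'d::finite" where
  "centre x0 dx I = (\<chi> j. x0 $ j + of_int (I $ j) * dx $ j)"

definition shift :: "int^'d \<Rightarrow> 'd::finite \<Rightarrow> int \<Rightarrow> int^'d" where
  "shift I i k = (\<chi> j. if j = i then I $ j + k else I $ j)"

definition source_bar ::
    "real \<Rightarrow> real \<Rightarrow> real \<Rightarrow> real \<Rightarrow> 'd::finite relax_state \<Rightarrow> 'd relax_state \<Rightarrow> real" where
  "source_bar \<alpha>L \<beta>L \<alpha>R \<beta>R WL WR =
     (let \<rho>L = density (conserved WL); \<rho>R = density (conserved WR) in
      (\<rho>R / \<alpha>R * \<beta>R - \<rho>L / \<alpha>L * \<beta>L) - 1/2 * (\<rho>R / \<alpha>R - \<rho>L / \<alpha>L) * (\<beta>R + \<beta>L))"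

text \<open>The interface I(i,1/2) between the cells I and I(i,1) is labelled by the pair I, i;
  hence I(i,-1/2) has the label I(i,-1), i. The relaxation parameter at the former is a I i.\<close>

definition mesh_iface ::
    "(real \<Rightarrow> real \<Rightarrow> real) \<Rightarrow> (real^'d \<Rightarrow> real) \<Rightarrow> (real^'d \<Rightarrow> real) \<Rightarrow> (real^'d \<Rightarrow> real) \<Rightarrow>
     real^'d \<Rightarrow> real^'d \<Rightarrow> (int^'d \<Rightarrow> 'd \<Rightarrow> real) \<Rightarrow> (int^'d \<Rightarrow> 'd state) \<Rightarrow>
     int^'d \<Rightarrow> 'd \<Rightarrow> 'd::finite iface" where
  "mesh_iface p \<Phi> \<alpha> \<beta> x0 dx a w I i =
     (let J = shift I i 1;
          xL = centre x0 dx I; xR = centre x0 dx J;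
          WL = relax_equilibrium p (\<Phi> xL) (w I);
          WR = relax_equilibrium p (\<Phi> xR) (w J)
      in \<lparr>dir = i, par_a = a I i, Sbar = source_bar (\<alpha> xL) (\<beta> xL) (\<alpha> xR) (\<beta> xR) WL WR,
          W_L = WL, W_R = WR\<rparr>)"

definition first_order_step ::
    "real \<Rightarrow> real^'d \<Rightarrow> (int^'d \<Rightarrow> 'd \<Rightarrow> 'd::finite iface) \<Rightarrow>
     (int^'d \<Rightarrow> 'd state) \<Rightarrow> int^'d \<Rightarrow> 'd state" where
  "first_order_step dt dx R w I =
     w I - dt *\<^sub>R (\<Sum>i\<in>UNIV. (1 / dx $ i) *\<^sub>R
       (fst (num_flux (R I i)) - snd (num_flux (R (shift I i (-1)) i))))"

text \<open>The supremum is taken in the extended reals, because the wave speeds on the infinite mesh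
  need not be bounded.\<close>

definition max_speed :: "(int^'d \<Rightarrow> 'd \<Rightarrow> 'd::finite iface) \<Rightarrow> 'd \<Rightarrow> ereal" where
  "max_speed R i =
     (SUP I. ereal (max \<bar>speed_minus (R I i)\<bar> (max \<bar>speed_u (R I i)\<bar> \<bar>speed_plus (R I i)\<bar>)))"

end

theory Submission
  imports Defs
begin

text \<open>
  The scheme is robust because every updated value is a convex combination of admissible states,
  and the admissible set is convex (\<open>convex_Omega\<close>).

  The reason that such a combination exists is that the interface solver is an exact solver for
  three discontinuities: across each wave the fluxes satisfy a Rankine-Hugoniot condition
  \<open>F (W') - F (W) = \<lambda> (w' - w)\<close>, where \<open>S\<close> is subtracted from the flux difference at the
  middle wave (\<open>left_wave_jump\<close>, \<open>middle_wave_jump\<close>, \<open>right_wave_jump\<close>). Hence \<open>F\<^sup>-\<close> differs from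
  the flux of the left cell by the jumps \<open>\<lambda> (w' - w)\<close> over the waves with \<open>\<lambda> < 0\<close> only, and \<open>F\<^sup>+\<close>
  differs from the flux of the right cell by those with \<open>\<lambda> > 0\<close> only (\<open>left_cell_flux\<close>,
  \<open>right_cell_flux\<close>). This is what all five branches of the numerical flux have in common.

  The two fluxes through the boundary of a cell in direction \<open>i\<close> can be compared with the flux
  \<open>F\<^sub>1 (W\<^sub>I)\<close> of the cell itself, which cancels. So the update is the mean of \<open>2 d\<close> one-sided updates,
  one for each face, in each of which the time step is enlarged by the factor \<open>2 d\<close>. Since the waves
  are ordered, an Abel summation turns a one-sided update into a combination of \<open>w\<^sub>L\<close>, \<open>w\<^sub>L\<^sup>*\<close>,
  \<open>w\<^sub>R\<^sup>*\<close>, \<open>w\<^sub>R\<close> with weights that sum to 1; they are nonnegative under the CFL condition, which says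
  that within the enlarged time step no wave crosses more than one cell.
\<close>

section \<open>Convexity of the admissible set\<close>

text \<open>In the frame that moves with velocity \<open>v\<close> the total energy per volume is
  \<open>\<rho> e + \<rho> |u - v|\<^sup>2 / 2\<close>. It is affine in the conserved variables for each \<open>v\<close>, and it is smallest
  for \<open>v = u\<close>, where it is the internal energy. This writes \<open>\<Omega>\<close> as an intersection of half-spaces.\<close>

lemma Omega_iff_energy_in_moving_frames:
  "w \<in> Omega \<longleftrightarrow> density w > 0 \<and>
     (\<forall>v. energy w - momentum w \<bullet> v + 1/2 * density w * (v \<bullet> v) > 0)"
proof (cases "density w > 0")
  case True
  define \<rho> u e where "\<rho> = density w" and "u = velocity w" and "e = internal_energy w"
  have \<rho>: "\<rho> > 0" using True by (simp add: \<rho>_def)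
  have m: "momentum w = \<rho> *\<^sub>R u"
    using \<rho> by (simp add: u_def \<rho>_def velocity_def)
  have E: "energy w = \<rho> * e + 1/2 * \<rho> * (u \<bullet> u)"
    using \<rho> by (simp add: e_def u_def \<rho>_def internal_energy_def dot_square_norm)
  have frame: "energy w - momentum w \<bullet> v + 1/2 * density w * (v \<bullet> v)
      = \<rho> * (e + 1/2 * ((u - v) \<bullet> (u - v)))" for v
    unfolding m E \<rho>_def[symmetric]
    by (simp add: inner_diff_left inner_diff_right inner_commute algebra_simps)
  have "e > 0 \<longleftrightarrow> (\<forall>v. \<rho> * (e + 1/2 * ((u - v) \<bullet> (u - v))) > 0)"
  proof
    assume "e > 0"
    then show "\<forall>v. \<rho> * (e + 1/2 * ((u - v) \<bullet> (u - v))) > 0"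
      using \<rho> by (auto intro!: mult_pos_pos add_pos_nonneg)
  next
    assume "\<forall>v. \<rho> * (e + 1/2 * ((u - v) \<bullet> (u - v))) > 0"
    then have "\<rho> * (e + 1/2 * ((u - u) \<bullet> (u - u))) > 0" by blast
    then show "e > 0" using \<rho> by (simp add: zero_less_mult_iff)
  qed
  then show ?thesis
    unfolding frame using True by (simp add: Omega_def e_def)
qed (simp add: Omega_def)

lemma convex_Omega: "convex (Omega :: 'd::finite state set)"
proof (rule convexI)
  fix x y :: "'d state" and s t :: real
  assume x: "x \<in> Omega" and y: "y \<in> Omega" and st: "0 \<le> s" "0 \<le> t" "s + t = 1"
  have comb: "s * b + t * c > 0" if "b > 0" "c > 0" for b c :: real
    using that st by (metis add_nonneg_pos add_pos_nonneg less_eq_real_def mult_pos_pos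
        mult_nonneg_nonneg add.right_neutral zero_neq_one mult_zero_left)
  let ?en = "\<lambda>w v. energy w - momentum w \<bullet> v + 1/2 * density w * (v \<bullet> v)"
  have affine: "?en (s *\<^sub>R x + t *\<^sub>R y) v = s * ?en x v + t * ?en y v" for v
    by (simp add: energy_def momentum_def density_def inner_add_left algebra_simps)
  have "density (s *\<^sub>R x + t *\<^sub>R y) = s * density x + t * density y"
    by (simp add: density_def)
  then show "s *\<^sub>R x + t *\<^sub>R y \<in> Omega"
    using x y unfolding Omega_iff_energy_in_moving_frames affine by (auto intro!: comb)
qed

section \<open>Jump relations of the interface solver\<close>

lemma state_of_density_velocity_internal_energy:
  assumes "density w \<noteq> 0"
  shows "state_of (density w) (velocity w) (internal_energy w) = w"
proof (cases w)
  case (fields \<rho> m E)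
  with assms show ?thesis
    by (simp add: state_of_def velocity_def internal_energy_def density_def momentum_def
        energy_def)
qed

lemma F1_state_of:
  assumes "conserved W = state_of \<rho> u e" and "\<rho> \<noteq> 0"
  shows "F1 i W = (\<rho> * u $ i, (\<rho> * u $ i) *\<^sub>R u + relax_pi W *\<^sub>R axis i 1,
    u $ i * (\<rho> * e + 1/2 * \<rho> * (u \<bullet> u) + relax_pi W))"
  using assms(2)
  by (simp add: F1_def Let_def assms(1) state_of_def velocity_def density_def momentum_def
      energy_def dot_square_norm)

text \<open>The two outer waves are shocks of the same kind, with mass flux \<open>c = a\<close> on the left and
  \<open>c = - a\<close> on the right. The mass flux through the wave is the same on both sides, so in the jump of
  \<open>F - \<lambda> w\<close> it multiplies the jumps of \<open>u\<close> and of the specific total energy; the pressure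
  relation then cancels the momentum jump, and the relation for \<open>e\<close> the energy jump.\<close>

lemma outer_wave_jump:
  assumes W: "conserved W = state_of \<rho> u e" and W': "conserved W' = state_of \<rho>' u' e'"
    and mass: "\<rho> * (u $ i - s) = c" and mass': "\<rho>' * (u' $ i - s) = c" and c: "c \<noteq> 0"
    and u': "u' = u + \<delta> *\<^sub>R axis i 1"
    and pi: "relax_pi W' = relax_pi W - c * \<delta>"
    and e': "e' = e + ((relax_pi W')\<^sup>2 - (relax_pi W)\<^sup>2) / (2 * c\<^sup>2)"
  shows "F1 i W' - F1 i W = s *\<^sub>R (conserved W' - conserved W)"
proof -
  have ne: "\<rho> \<noteq> 0" "\<rho>' \<noteq> 0" using mass mass' c by auto
  have ui: "u' $ i = u $ i + \<delta>" by (simp add: u')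
  have uu: "u' \<bullet> u' = u \<bullet> u + 2 * \<delta> * u $ i + \<delta>\<^sup>2"
    by (simp add: u' inner_add_left inner_add_right inner_axis inner_axis' power2_eq_square
        algebra_simps)
  have m: "\<rho> * u $ i = c + \<rho> * s" and m': "\<rho>' * u' $ i = c + \<rho>' * s"
    using mass mass' by (simp_all add: algebra_simps)
  have e: "c * (e' - e) = - \<delta> * relax_pi W + c * \<delta>\<^sup>2 / 2"
    unfolding e' pi using c by (simp add: field_simps power2_eq_square)
  have momentum: "((\<rho>' * u' $ i) *\<^sub>R u' + relax_pi W' *\<^sub>R axis i 1)
      - ((\<rho> * u $ i) *\<^sub>R u + relax_pi W *\<^sub>R axis i 1) = s *\<^sub>R (\<rho>' *\<^sub>R u' - \<rho> *\<^sub>R u)"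
    unfolding m m' pi by (simp add: u' algebra_simps)
  have "u' $ i * (\<rho>' * e' + 1/2 * \<rho>' * (u' \<bullet> u') + relax_pi W')
      - u $ i * (\<rho> * e + 1/2 * \<rho> * (u \<bullet> u) + relax_pi W)
    = (\<rho>' * u' $ i) * (e' + 1/2 * (u' \<bullet> u')) - (\<rho> * u $ i) * (e + 1/2 * (u \<bullet> u))
      + u' $ i * relax_pi W' - u $ i * relax_pi W"
    by (simp add: algebra_simps)
  also have "\<dots> = s * (\<rho>' * (e' + 1/2 * (u' \<bullet> u')) - \<rho> * (e + 1/2 * (u \<bullet> u)))
      + c * (e' - e) + c / 2 * (u' \<bullet> u' - u \<bullet> u) + u' $ i * relax_pi W' - u $ i * relax_pi W"
    unfolding m m' by (simp add: field_simps)
  also have "\<dots> = s * (\<rho>' * (e' + 1/2 * (u' \<bullet> u')) - \<rho> * (e + 1/2 * (u \<bullet> u)))"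
    unfolding e uu ui pi by (simp add: algebra_simps power2_eq_square)
  finally have energy: "u' $ i * (\<rho>' * e' + 1/2 * \<rho>' * (u' \<bullet> u') + relax_pi W')
      - u $ i * (\<rho> * e + 1/2 * \<rho> * (u \<bullet> u) + relax_pi W)
    = s * ((\<rho>' * e' + 1/2 * \<rho>' * (u' \<bullet> u')) - (\<rho> * e + 1/2 * \<rho> * (u \<bullet> u)))"
    by (simp add: algebra_simps)
  show ?thesis
    unfolding F1_state_of[OF W ne(1)] F1_state_of[OF W' ne(2)]
    using m m' momentum energy
    by (simp add: W W' state_of_def dot_square_norm algebra_simps)
qed

text \<open>The middle wave moves with the fluid, so that the jump of \<open>F - \<lambda> w\<close> consists of the pressure
  terms alone.\<close>

lemma contact_wave_jump:
  assumes W: "conserved W = state_of \<rho> u e" and W': "conserved W' = state_of \<rho>' u' e'"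
    and ne: "\<rho> \<noteq> 0" "\<rho>' \<noteq> 0" and ui: "u $ i = s" "u' $ i = s"
  shows "F1 i W' - F1 i W = s *\<^sub>R (conserved W' - conserved W)
    + (0, (relax_pi W' - relax_pi W) *\<^sub>R axis i 1, s * (relax_pi W' - relax_pi W))"
  unfolding F1_state_of[OF W ne(1)] F1_state_of[OF W' ne(2)]
  by (simp add: W W' ui state_of_def dot_square_norm algebra_simps)

definition admissible_iface :: "'d::finite iface \<Rightarrow> bool" where
  "admissible_iface R \<longleftrightarrow>
     sufficiently_large R \<and> conserved (W_L R) \<in> Omega \<and> conserved (W_R R) \<in> Omega"

lemma admissible_iface_positive:
  assumes "admissible_iface R"
  shows "par_a R > 0" "rho_L R > 0" "rho_R R > 0" "rho_L_star R > 0" "rho_R_star R > 0"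
  using assms
  by (auto simp: admissible_iface_def sufficiently_large_def Omega_def rho_L_def rho_R_def
      W_L_star_def W_R_star_def state_of_def density_def)

text \<open>The formulas for the intermediate densities say that
  \<open>u\<^sup>* - a / \<rho>\<^sub>L\<^sup>* = u\<^sub>L - a / \<rho>\<^sub>L = \<lambda>\<^sup>-\<close> and \<open>u\<^sup>* + a / \<rho>\<^sub>R\<^sup>* = u\<^sub>R + a / \<rho>\<^sub>R = \<lambda>\<^sup>+\<close>.\<close>

lemma left_wave_jump:
  assumes "admissible_iface R"
  shows "F1 (dir R) (W_L_star R) - F1 (dir R) (W_L R)
    = speed_minus R *\<^sub>R (conserved (W_L_star R) - conserved (W_L R))"
proof -
  note pos = admissible_iface_positive[OF assms]
  have inv: "1 / rho_L_star R = 1 / rho_L R + 1 / par_a R * (u_star R - u_L R)"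
    by (simp add: rho_L_star_def)
  have "par_a R * (1 / rho_L_star R) = par_a R / rho_L R + (u_star R - u_L R)"
    unfolding inv using pos(1) by (simp add: distrib_left)
  then have s: "u_star R - speed_minus R = par_a R / rho_L_star R"
    by (simp add: speed_minus_def)
  have pi: "relax_pi (W_L_star R) = pi_L_star R"
    using pos by (simp add: relax_pi_def W_L_star_def state_of_def density_def)
  show ?thesis
  proof (rule outer_wave_jump)
    show "conserved (W_L R) = state_of (rho_L R) (velocity (conserved (W_L R))) (e_L R)"
      using pos
      by (simp add: rho_L_def e_L_def state_of_density_velocity_internal_energy)
    show "conserved (W_L_star R) = state_of (rho_L_star R) (vel_L_star R) (e_L_star R)"
      by (simp add: W_L_star_def)
    show "rho_L R * (velocity (conserved (W_L R)) $ dir R - speed_minus R) = par_a R"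
      using pos by (simp add: speed_minus_def u_L_def)
    show "rho_L_star R * (vel_L_star R $ dir R - speed_minus R) = par_a R"
      using pos s by (simp add: vel_L_star_def)
    show "par_a R \<noteq> 0" using pos by simp
    show "vel_L_star R = velocity (conserved (W_L R)) + (u_star R - u_L R) *\<^sub>R axis (dir R) 1"
      by (simp add: vec_eq_iff vel_L_star_def u_L_def axis_def)
    show "relax_pi (W_L_star R) = relax_pi (W_L R) - par_a R * (u_star R - u_L R)"
      unfolding pi by (simp add: pi_L_star_def pi_L_def algebra_simps)
    show "e_L_star R
        = e_L R + ((relax_pi (W_L_star R))\<^sup>2 - (relax_pi (W_L R))\<^sup>2) / (2 * (par_a R)\<^sup>2)"
      unfolding pi by (simp add: e_L_star_def pi_L_def)
  qed
qed

lemma right_wave_jump: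
  assumes "admissible_iface R"
  shows "F1 (dir R) (W_R R) - F1 (dir R) (W_R_star R)
    = speed_plus R *\<^sub>R (conserved (W_R R) - conserved (W_R_star R))"
proof -
  note pos = admissible_iface_positive[OF assms]
  have inv: "1 / rho_R_star R = 1 / rho_R R + 1 / par_a R * (u_R R - u_star R)"
    by (simp add: rho_R_star_def)
  have "par_a R * (1 / rho_R_star R) = par_a R / rho_R R + (u_R R - u_star R)"
    unfolding inv using pos(1) by (simp add: distrib_left)
  then have s: "u_star R - speed_plus R = - (par_a R / rho_R_star R)"
    by (simp add: speed_plus_def)
  have pi: "relax_pi (W_R_star R) = pi_R_star R"
    using pos by (simp add: relax_pi_def W_R_star_def state_of_def density_def)
  have "F1 (dir R) (W_R_star R) - F1 (dir R) (W_R R)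
    = speed_plus R *\<^sub>R (conserved (W_R_star R) - conserved (W_R R))"
  proof (rule outer_wave_jump)
    show "conserved (W_R R) = state_of (rho_R R) (velocity (conserved (W_R R))) (e_R R)"
      using pos
      by (simp add: rho_R_def e_R_def state_of_density_velocity_internal_energy)
    show "conserved (W_R_star R) = state_of (rho_R_star R) (vel_R_star R) (e_R_star R)"
      by (simp add: W_R_star_def)
    show "rho_R R * (velocity (conserved (W_R R)) $ dir R - speed_plus R) = - par_a R"
      using pos by (simp add: speed_plus_def u_R_def)
    show "rho_R_star R * (vel_R_star R $ dir R - speed_plus R) = - par_a R"
      using pos s by (simp add: vel_R_star_def)
    show "- par_a R \<noteq> 0" using pos by simp
    show "vel_R_star R = velocity (conserved (W_R R)) + (u_star R - u_R R) *\<^sub>R axis (dir R) 1"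
      by (simp add: vec_eq_iff vel_R_star_def u_R_def axis_def)
    show "relax_pi (W_R_star R) = relax_pi (W_R R) - - par_a R * (u_star R - u_R R)"
      unfolding pi by (simp add: pi_R_star_def pi_R_def)
    show "e_R_star R
        = e_R R + ((relax_pi (W_R_star R))\<^sup>2 - (relax_pi (W_R R))\<^sup>2) / (2 * (- par_a R)\<^sup>2)"
      unfolding pi by (simp add: e_R_star_def pi_R_def)
  qed
  then show ?thesis by (simp add: algebra_simps)
qed

text \<open>The value of \<open>u\<^sup>*\<close> is the one for which the pressure jump \<open>\<pi>\<^sub>R\<^sup>* - \<pi>\<^sub>L\<^sup>*\<close> balances the source.\<close>

lemma middle_wave_jump:
  assumes "admissible_iface R"
  shows "F1 (dir R) (W_R_star R) - F1 (dir R) (W_L_star R)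
    = speed_u R *\<^sub>R (conserved (W_R_star R) - conserved (W_L_star R)) + flux_source R"
proof -
  note pos = admissible_iface_positive[OF assms]
  have pi: "relax_pi (W_L_star R) = pi_L_star R" "relax_pi (W_R_star R) = pi_R_star R"
    using pos
    by (simp_all add: relax_pi_def W_L_star_def W_R_star_def state_of_def density_def)
  have "2 * par_a R * u_star R = par_a R * (u_L R + u_R R) - (pi_R R - pi_L R - Sbar R)"
    using pos(1) by (simp add: u_star_def field_simps)
  then have balance: "relax_pi (W_R_star R) - relax_pi (W_L_star R) = Sbar R"
    unfolding pi by (simp add: pi_L_star_def pi_R_star_def algebra_simps)
  have "F1 (dir R) (W_R_star R) - F1 (dir R) (W_L_star R)
    = speed_u R *\<^sub>R (conserved (W_R_star R) - conserved (W_L_star R))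
      + (0, (relax_pi (W_R_star R) - relax_pi (W_L_star R)) *\<^sub>R axis (dir R) 1,
         speed_u R * (relax_pi (W_R_star R) - relax_pi (W_L_star R)))"
    using pos
    by (intro contact_wave_jump[where \<rho> = "rho_L_star R" and u = "vel_L_star R"
          and e = "e_L_star R" and \<rho>' = "rho_R_star R" and u' = "vel_R_star R"
          and e' = "e_R_star R"])
      (simp_all add: W_L_star_def W_R_star_def vel_L_star_def vel_R_star_def speed_u_def)
  then show ?thesis by (simp add: balance flux_source_def)
qed

section \<open>One-sided updates at an interface\<close>

text \<open>Each flux is obtained from the flux of the adjacent cell by adding the jumps over the waves that
  enter this cell. If \<open>\<lambda>\<^sup>u = 0\<close>, then the middle wave enters neither cell; this is why the two fluxes
  belong to different intermediate states in that case.\<close>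

lemma left_cell_flux:
  assumes "admissible_iface R"
  shows "fst (num_flux R) - F1 (dir R) (W_L R)
    = min (speed_minus R) 0 *\<^sub>R (conserved (W_L_star R) - conserved (W_L R))
    + min (speed_u R) 0 *\<^sub>R (conserved (W_R_star R) - conserved (W_L_star R))
    + min (speed_plus R) 0 *\<^sub>R (conserved (W_R R) - conserved (W_R_star R))"
proof -
  have ord: "speed_minus R < speed_u R" "speed_u R < speed_plus R"
    using assms by (auto simp: admissible_iface_def sufficiently_large_def)
  show ?thesis
    unfolding num_flux_def Let_def
    using ord left_wave_jump[OF assms] middle_wave_jump[OF assms] right_wave_jump[OF assms]
    unfolding diff_eq_eq by (auto simp: min_def)
qed

lemma right_cell_flux:
  assumes "admissible_iface R"
  shows "F1 (dir R) (W_R R) - snd (num_flux R)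
    = max (speed_minus R) 0 *\<^sub>R (conserved (W_L_star R) - conserved (W_L R))
    + max (speed_u R) 0 *\<^sub>R (conserved (W_R_star R) - conserved (W_L_star R))
    + max (speed_plus R) 0 *\<^sub>R (conserved (W_R R) - conserved (W_R_star R))"
proof -
  have ord: "speed_minus R < speed_u R" "speed_u R < speed_plus R"
    using assms by (auto simp: admissible_iface_def sufficiently_large_def)
  show ?thesis
    unfolding num_flux_def Let_def
    using ord left_wave_jump[OF assms] middle_wave_jump[OF assms] right_wave_jump[OF assms]
    unfolding diff_eq_eq by (auto simp: max_def)
qed

text \<open>Waves of ordered nonpositive speeds \<open>r \<le> s \<le> t\<close> carry \<open>b\<close>, \<open>c\<close>, \<open>d\<close> into a cell with value \<open>a\<close>.
  Collecting the coefficient of each state, the new cell average is the mixture with the weights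
  \<open>1 + k r\<close>, \<open>k (s - r)\<close>, \<open>k (t - s)\<close>, \<open>- k t\<close>, the fractions of the cell that the states
  occupy.\<close>

lemma incoming_waves_mem_convex:
  fixes a b c d :: "'v::real_vector"
  assumes "convex C" and mem: "a \<in> C" "b \<in> C" "c \<in> C" "d \<in> C"
    and ord: "r \<le> s" "s \<le> t" "t \<le> 0" and "k \<ge> 0" and cfl: "- (k * r) \<le> 1"
  shows "a - k *\<^sub>R (r *\<^sub>R (b - a) + s *\<^sub>R (c - b) + t *\<^sub>R (d - c)) \<in> C"
proof -
  define wt where "wt = (\<lambda>n::nat. [1 + k * r, k * (s - r), k * (t - s), - (k * t)] ! n)"
  define st where "st = (\<lambda>n::nat. [a, b, c, d] ! n)"
  have four: "{..<4::nat} = {0, 1, 2, 3}" by auto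
  have "(\<Sum>n<4. wt n *\<^sub>R st n) \<in> C"
  proof (rule convex_sum)
    show "(\<Sum>n<4. wt n) = 1" by (simp add: four wt_def algebra_simps)
    have "k * t \<le> 0" using assms by (simp add: mult_nonneg_nonpos)
    then show "wt n \<ge> 0" if "n \<in> {..<4}" for n
      using that assms unfolding four wt_def by (auto simp: numeral_2_eq_2 numeral_3_eq_3)
    show "st n \<in> C" if "n \<in> {..<4}" for n
      using that mem unfolding four st_def by (auto simp: numeral_2_eq_2 numeral_3_eq_3)
  qed (use assms in auto)
  also have "(\<Sum>n<4. wt n *\<^sub>R st n)
      = a - k *\<^sub>R (r *\<^sub>R (b - a) + s *\<^sub>R (c - b) + t *\<^sub>R (d - c))"
    by (simp add: four wt_def st_def algebra_simps)
  finally show ?thesis .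
qed

lemma left_cell_update_mem_Omega:
  assumes R: "admissible_iface R" and "k \<ge> 0" and cfl: "k * \<bar>speed_minus R\<bar> \<le> 1"
  shows "conserved (W_L R) - k *\<^sub>R (fst (num_flux R) - F1 (dir R) (W_L R)) \<in> Omega"
  unfolding left_cell_flux[OF R]
proof (rule incoming_waves_mem_convex[OF convex_Omega])
  have "k * - min (speed_minus R) 0 \<le> k * \<bar>speed_minus R\<bar>"
    using \<open>k \<ge> 0\<close> by (intro mult_left_mono) auto
  then show "- (k * min (speed_minus R) 0) \<le> 1" using cfl by simp
qed (use R \<open>k \<ge> 0\<close> in \<open>auto simp: admissible_iface_def sufficiently_large_def\<close>)

text \<open>Mirrored: seen from the right cell, the waves come in with the speeds \<open>- \<lambda>\<close> and in reverse
  order.\<close>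

lemma right_cell_update_mem_Omega:
  assumes R: "admissible_iface R" and "k \<ge> 0" and cfl: "k * \<bar>speed_plus R\<bar> \<le> 1"
  shows "conserved (W_R R) - k *\<^sub>R (F1 (dir R) (W_R R) - snd (num_flux R)) \<in> Omega"
proof -
  let ?L = "conserved (W_L R)" and ?L' = "conserved (W_L_star R)"
    and ?R' = "conserved (W_R_star R)" and ?R = "conserved (W_R R)"
  have "?R - k *\<^sub>R (- max (speed_plus R) 0 *\<^sub>R (?R' - ?R)
      + - max (speed_u R) 0 *\<^sub>R (?L' - ?R') + - max (speed_minus R) 0 *\<^sub>R (?L - ?L')) \<in> Omega"
  proof (rule incoming_waves_mem_convex[OF convex_Omega])
    have "k * max (speed_plus R) 0 \<le> k * \<bar>speed_plus R\<bar>"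
      using \<open>k \<ge> 0\<close> by (intro mult_left_mono) auto
    then show "- (k * - max (speed_plus R) 0) \<le> 1" using cfl by simp
  qed (use R \<open>k \<ge> 0\<close> in \<open>auto simp: admissible_iface_def sufficiently_large_def\<close>)
  then show ?thesis unfolding right_cell_flux[OF R] by (simp add: algebra_simps)
qed

section \<open>Robustness of the scheme\<close>

text \<open>The reference fluxes \<open>G i\<close> are free because they enter the two faces of direction \<open>i\<close> with
  opposite signs.\<close>

lemma update_as_mean_of_one_sided_updates:
  fixes x :: "'v::real_vector" and A B G :: "'d::finite \<Rightarrow> 'v"
  assumes "\<And>i. k i = 2 * real CARD('d) * h i"
  shows "x - (\<Sum>i\<in>UNIV. h i *\<^sub>R (A i - B i))
    = (\<Sum>i\<in>UNIV. (1 / real CARD('d)) *\<^sub>R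
        ((1/2) *\<^sub>R (x - k i *\<^sub>R (A i - G i)) + (1/2) *\<^sub>R (x - k i *\<^sub>R (G i - B i))))"
proof -
  have "(1/2) *\<^sub>R (x - k i *\<^sub>R (A i - G i)) + (1/2) *\<^sub>R (x - k i *\<^sub>R (G i - B i))
      = x - (real CARD('d) * h i) *\<^sub>R (A i - B i)" for i
  proof -
    have "(1/2) *\<^sub>R (x - k i *\<^sub>R (A i - G i)) + (1/2) *\<^sub>R (x - k i *\<^sub>R (G i - B i))
        = (1/2) *\<^sub>R (x + x) - (1/2 * k i) *\<^sub>R (A i - B i)"
      by (simp add: algebra_simps)
    then show ?thesis by (simp add: assms flip: scaleR_2)
  qed
  then show ?thesis
    by (simp add: scaleR_right_diff_distrib sum_subtractf sum_constant_scaleR)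
qed

lemma shift_shift: "shift (shift I i j) i k = shift I i (j + k)"
  by (simp add: shift_def vec_eq_iff)

lemma shift_0: "shift I i 0 = I"
  by (simp add: shift_def vec_eq_iff)

lemma CFL_bound:
  assumes "h > 0" and "ereal h * max_speed R i < ereal c"
  shows "h * \<bar>speed_minus (R I i)\<bar> < c" "h * \<bar>speed_plus (R I i)\<bar> < c"
proof -
  let ?m = "max \<bar>speed_minus (R I i)\<bar> (max \<bar>speed_u (R I i)\<bar> \<bar>speed_plus (R I i)\<bar>)"
  have "ereal ?m \<le> max_speed R i"
    unfolding max_speed_def by (rule SUP_upper) simp
  then have "ereal h * ereal ?m \<le> ereal h * max_speed R i"
    using \<open>h > 0\<close> by (intro ereal_mult_left_mono) auto
  then have "ereal (h * ?m) < ereal c"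
    using assms(2) by (metis order.strict_trans1 times_ereal.simps(1))
  then have m: "h * ?m < c" by simp
  have "h * \<bar>speed_minus (R I i)\<bar> \<le> h * ?m" "h * \<bar>speed_plus (R I i)\<bar> \<le> h * ?m"
    using \<open>h > 0\<close> by (intro mult_left_mono; simp)+
  then show "h * \<bar>speed_minus (R I i)\<bar> < c" "h * \<bar>speed_plus (R I i)\<bar> < c"
    using m by linarith+
qed

theorem theorem10:
  fixes p :: "real \<Rightarrow> real \<Rightarrow> real"
    and \<Phi> \<alpha> \<beta> :: "real^'d::finite \<Rightarrow> real"
    and grad_\<Phi> :: "real^'d \<Rightarrow> real^'d"
    and x0 dx :: "real^'d"
    and dt :: real
    and a :: "int^'d \<Rightarrow> 'd \<Rightarrow> real"
    and w :: "int^'d \<Rightarrow> 'd state"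
  assumes "\<And>x. \<alpha> x > 0" and "\<And>x. \<beta> x > 0"
    and "\<And>x. GDERIV \<Phi> x :> grad_\<Phi> x"
    and "\<And>x. GDERIV \<beta> x :> - (\<alpha> x *\<^sub>R grad_\<Phi> x)"
    and "\<And>i. dx $ i > 0" and "dt > 0"
    and "\<And>I. w I \<in> Omega"
    and "\<And>I i. sufficiently_large (mesh_iface p \<Phi> \<alpha> \<beta> x0 dx a w I i)"
    and "\<And>i. ereal (dt / dx $ i) * max_speed (mesh_iface p \<Phi> \<alpha> \<beta> x0 dx a w) i
              < ereal (1 / (2 * real CARD('d)))"
  shows "\<forall>I. first_order_step dt dx (mesh_iface p \<Phi> \<alpha> \<beta> x0 dx a w) w I \<in> Omega"
proof
  fix I :: "int^'d"
  define R where "R = mesh_iface p \<Phi> \<alpha> \<beta> x0 dx a w"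
  define W where "W = relax_equilibrium p (\<Phi> (centre x0 dx I)) (w I)"
  define k where "k i = 2 * real CARD('d) * (dt / dx $ i)" for i
  let ?I' = "\<lambda>i. shift I i (-1)"
  have adm: "admissible_iface (R J i)" for J i
    using assms(7,8)
    by (simp add: admissible_iface_def R_def mesh_iface_def Let_def relax_equilibrium_def)
  have dirs: "dir (R J i) = i" for J i
    by (simp add: R_def mesh_iface_def Let_def)
  \<comment> \<open>Both faces of the cell in direction i see the same relaxation state of the cell; hence
    the reference flux is the same for both.\<close>
  have WL: "W_L (R I i) = W" and WR: "W_R (R (?I' i) i) = W" for i
    by (simp_all add: R_def W_def mesh_iface_def Let_def shift_shift shift_0)
  have consW: "conserved W = w I"
    by (simp add: W_def relax_equilibrium_def)
  have h_pos: "dt / dx $ i > 0" for i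
    using assms(5,6) by simp
  have k_nonneg: "k i \<ge> 0" for i
    unfolding k_def using h_pos[of i] by (intro mult_nonneg_nonneg) simp_all
  have CFL: "k i * \<bar>speed_minus (R J i)\<bar> \<le> 1" "k i * \<bar>speed_plus (R J i)\<bar> \<le> 1" for J i
    using CFL_bound[OF h_pos assms(9), of i J]
    by (simp_all add: k_def R_def field_simps)
  have left: "w I - k i *\<^sub>R (fst (num_flux (R I i)) - F1 i W) \<in> Omega" for i
    using left_cell_update_mem_Omega[OF adm k_nonneg CFL(1), of I i]
    by (simp add: dirs WL consW)
  have right: "w I - k i *\<^sub>R (F1 i W - snd (num_flux (R (?I' i) i))) \<in> Omega" for i
    using right_cell_update_mem_Omega[OF adm k_nonneg CFL(2), of "?I' i" i]
    by (simp add: dirs WR consW)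
  have "first_order_step dt dx R w I
      = w I - (\<Sum>i\<in>UNIV. (dt / dx $ i) *\<^sub>R
          (fst (num_flux (R I i)) - snd (num_flux (R (?I' i) i))))"
    by (simp add: first_order_step_def scaleR_sum_right)
  also have "\<dots> = (\<Sum>i\<in>UNIV. (1 / real CARD('d)) *\<^sub>R
        ((1/2) *\<^sub>R (w I - k i *\<^sub>R (fst (num_flux (R I i)) - F1 i W))
         + (1/2) *\<^sub>R (w I - k i *\<^sub>R (F1 i W - snd (num_flux (R (?I' i) i))))))"
    by (rule update_as_mean_of_one_sided_updates) (simp add: k_def)
  also have "\<dots> \<in> Omega"
    by (rule convex_sum[OF _ convex_Omega])
      (use left right in \<open>auto intro!: convexD[OF convex_Omega]\<close>)
  finally show "first_order_step dt dx (mesh_iface p \<Phi> \<alpha> \<beta> x0 dx a w) w I \<in> Omega"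
    by (simp add: R_def)
qed

end
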